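(* Consider the following randomized online algorithm with parameter $c$: for each machine $i$ it independently picks $x_i \in (0,1]$ uniformly at random; a job of size $w$, when considered by machine $i$, falls in the unique interval $(c^{k+x_i}, c^{k+1+x_i}]$ with $k$ an integer. When a job arrives, the machines are checked in order of decreasing speed (ties broken in an arbitrary but fixed way); the job is assigned to the first machine that does not currently hold a job in the same or a larger interval (larger $k$), and otherwise passed to the next machine. For $c \ge e$, this randomized algorithm has competitive ratio $\min\left( \frac{c-1}{c \ln(c)}, h(c) \right)$. In particular, for $c=3.55829$, the randomized algorithm has competitive ratio approximately $0.5664$.
   Context: Online bipartite matching with decomposable weights and free disposal: $G=(V_1\cup V_2, V_1\times V_2)$ is a complete bipartite graph; vertices $u\in V_1$ ("machines") have known speeds $s(u)>0$, vertices $v\in V_2$ ("jobs") arrive online with sizes $w(v)>0$ revealed on arrival, and the weight of edge $(u,v)$ is $s(u)\cdot w(v)$. Each arriving job must be irrevocably assigned to a machine; a machine may receive several jobs but its reward is its speed times the maximum size of a job assigned to it; the objective is to maximize the total reward. Define $h(c) = 1-\frac{1}{\beta}W\left( \frac{\beta e^\beta}{c} \right)$ where $\beta = \frac{c \ln(c)}{c-1}-1$ and $W$ is the Lambert W function (inverse of $x\mapsto x e^x$). *)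

theory Defs
  imports "HOL-Probability.Probability"
begin

section \<open>Online matching with decomposable weights and free disposal\<close>

text \<open>
  A history lists the jobs in order of arrival, each given by its size together with the machine
  it was assigned to; \<open>None\<close> means that the job is discarded.
\<close>

type_synonym 'm history = "(real \<times> 'm option) list"

text \<open>Sizes are positive, so inserting \<open>0\<close> only matters for a machine without jobs.\<close>

definition total_reward :: "'m set \<Rightarrow> ('m \<Rightarrow> real) \<Rightarrow> 'm history \<Rightarrow> real" where
  "total_reward V s h = (\<Sum>u\<in>V. s u * Max (insert 0 {w. (w, Some u) \<in> set h}))"

definition offline_opt :: "'m set \<Rightarrow> ('m \<Rightarrow> real) \<Rightarrow> real list \<Rightarrow> real" where
  "offline_opt V s ws =
     Max {total_reward V s (zip ws as) | as.
            length as = length ws \<and> set as \<subseteq> insert None (Some ` V)}"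

text \<open>
  The order in which machines are checked. Quantifying over all such lists covers every fixed way
  of breaking ties between machines of equal speed.
\<close>

definition checking_order :: "'m set \<Rightarrow> ('m \<Rightarrow> real) \<Rightarrow> 'm list \<Rightarrow> bool" where
  "checking_order V s ms \<longleftrightarrow> set ms = V \<and> distinct ms \<and> sorted_wrt (\<lambda>u v. s u \<ge> s v) ms"

section \<open>The randomized algorithm\<close>

definition interval_index :: "real \<Rightarrow> real \<Rightarrow> real \<Rightarrow> int" where
  "interval_index c y w =
     (THE k::int. w \<in> {c powr (of_int k + y) <.. c powr (of_int k + 1 + y)})"

text \<open>
  The job currently held by a machine is the largest one assigned to it so far. The index is monotone
  in the size, so it is equivalent to compare with any job assigned to the machine.
\<close>

definition blocked :: "real \<Rightarrow> ('m \<Rightarrow> real) \<Rightarrow> 'm history \<Rightarrow> real \<Rightarrow> 'm \<Rightarrow> bool" where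
  "blocked c x h w u \<longleftrightarrow>
     (\<exists>w'. (w', Some u) \<in> set h \<and> interval_index c (x u) w' \<ge> interval_index c (x u) w)"

definition choose_machine ::
  "real \<Rightarrow> ('m \<Rightarrow> real) \<Rightarrow> 'm list \<Rightarrow> 'm history \<Rightarrow> real \<Rightarrow> 'm option" where
  "choose_machine c x ms h w = find (\<lambda>u. \<not> blocked c x h w u) ms"

definition run_algorithm ::
  "real \<Rightarrow> ('m \<Rightarrow> real) \<Rightarrow> 'm list \<Rightarrow> real list \<Rightarrow> 'm history" where
  "run_algorithm c x ms ws = foldl (\<lambda>h w. h @ [(w, choose_machine c x ms h w)]) [] ws"

definition offsets :: "'m set \<Rightarrow> ('m \<Rightarrow> real) measure" where
  "offsets V = Pi\<^sub>M V (\<lambda>_. uniform_measure lborel {0<..1})"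

definition expected_reward ::
  "real \<Rightarrow> 'm set \<Rightarrow> ('m \<Rightarrow> real) \<Rightarrow> 'm list \<Rightarrow> real list \<Rightarrow> real" where
  "expected_reward c V s ms ws =
     (\<integral>x. total_reward V s (run_algorithm c x ms ws) \<partial>offsets V)"

section \<open>Competitive ratio\<close>

text \<open>
  The performance \<open>R V s ms ws\<close> of an algorithm on machines \<open>V\<close> with speeds \<open>s\<close>, checking order
  \<open>ms\<close> and arriving job sizes \<open>ws\<close> is compared with the offline optimum. The instance, including
  the arrival order, does not depend on the random choices of the algorithm. As usual for
  maximization problems, a competitive ratio is a guarantee valid on every instance.
\<close>

definition has_competitive_ratio ::
  "('m set \<Rightarrow> ('m \<Rightarrow> real) \<Rightarrow> 'm list \<Rightarrow> real list \<Rightarrow> real) \<Rightarrow> real \<Rightarrow> bool" where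
  "has_competitive_ratio R r \<longleftrightarrow>
     (\<forall>V s ms ws. finite V \<longrightarrow> (\<forall>u\<in>V. s u > 0) \<longrightarrow> checking_order V s ms \<longrightarrow>
        (\<forall>w\<in>set ws. w > 0) \<longrightarrow> R V s ms ws \<ge> r * offline_opt V s ws)"

section \<open>The bound\<close>

text \<open>The principal branch, on which \<open>x * exp x\<close> is injective; it is only used at positive
  arguments.\<close>

definition Lambert_W :: "real \<Rightarrow> real" where
  "Lambert_W = the_inv_into {-1..} (\<lambda>x. x * exp x)"

definition beta :: "real \<Rightarrow> real" where
  "beta c = c * ln c / (c - 1) - 1"

definition h_bound :: "real \<Rightarrow> real" where
  "h_bound c = 1 - 1 / beta c * Lambert_W (beta c * exp (beta c) / c)"

end

theory Submission
  imports Defs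
begin

text \<open>
  Summation by parts over the prefixes of the checking order reduces the claim to machines of unit
  speed, where the optimum is the sum of a multiset \<open>A\<close> of at most as many jobs as machines. A
  machine passes the jobs that it rejects on to the next one, so one argues by induction on the
  machines: \<open>A\<close> loses the jobs accepted by the first machine, or its smallest job if there are none,
  and the loss is compared with the expected reward of the first machine. Let \<open>M\<close> be the largest job
  and call a job a record if it exceeds all earlier ones. If some record lies in \<open>[M / c, Min A)\<close>,
  then at most one job of \<open>A\<close> is accepted, so the loss is at most \<open>M\<close>, while the expected reward is at
  least \<open>(c - 1) / (c * ln c) * M\<close>. Otherwise the loss is at most the total size of the accepted
  jobs, whose expectation times \<open>h_bound c\<close> is at most the expected reward. Both expectations are
  sums over the records, because a job of size \<open>w\<close> has a larger index than one of size \<open>a < w\<close> with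
  probability \<open>min 1 (log c (w / a))\<close>; the second inequality is proved by induction on the jobs, after
  replacing \<open>M / c\<close> by a variable level \<open>a\<close>.
\<close>

section \<open>Accepted and rejected jobs at a single machine\<close>

definition mx :: "real list \<Rightarrow> real" where
  "mx h = Max (insert 0 (set h))"

lemma mx_Nil [simp]: "mx [] = 0"
  by (simp add: mx_def)

lemma mx_Cons [simp]: "mx (w # h) = max w (mx h)"
proof -
  have "insert 0 (insert w (set h)) = insert w (insert 0 (set h))" by auto
  then show ?thesis by (simp add: mx_def)
qed

lemma mx_nonneg: "0 \<le> mx h"
  by (simp add: mx_def)

lemma mx_ge: "w \<in> set h \<Longrightarrow> w \<le> mx h"
  by (simp add: mx_def)

lemma mx_cases: "mx h = 0 \<or> mx h \<in> set h"
  by (induction h) (auto simp: max_def)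

lemma mx_in_set: "h \<noteq> [] \<Longrightarrow> \<forall>w\<in>set h. 0 < w \<Longrightarrow> mx h \<in> set h"
  by (cases h) (use mx_cases[of h] mx_ge[of "hd h" h] in auto)

lemma mx_pos: "h \<noteq> [] \<Longrightarrow> \<forall>w\<in>set h. 0 < w \<Longrightarrow> 0 < mx h"
  using mx_in_set by blast

text \<open>Job lists have the latest job first. A machine accepts a job iff its index exceeds the index
  of every job offered to the machine before, since rejected jobs are dominated by accepted ones.\<close>

fun accepted :: "(real \<Rightarrow> int) \<Rightarrow> real list \<Rightarrow> real list" where
  "accepted f [] = []"
| "accepted f (w # h) = (if \<forall>v\<in>set h. f v < f w then w # accepted f h else accepted f h)"

fun rejected :: "(real \<Rightarrow> int) \<Rightarrow> real list \<Rightarrow> real list" where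
  "rejected f [] = []"
| "rejected f (w # h) = (if \<forall>v\<in>set h. f v < f w then rejected f h else w # rejected f h)"

lemma mset_accepted_rejected: "mset h = mset (accepted f h) + mset (rejected f h)"
  by (induction h) auto

lemma set_accepted: "set (accepted f h) \<subseteq> set h"
  by (induction h) auto

lemma set_rejected: "set (rejected f h) \<subseteq> set h"
  by (induction h) auto

lemma length_rejected: "length (rejected f h) \<le> length h"
  by (induction h) auto

text \<open>A rejected job is matched or exceeded in index by some earlier job; going back through
  such jobs ends at an accepted one.\<close>

lemma accepted_dominates: "v \<in> set h \<Longrightarrow> \<exists>u\<in>set (accepted f h). f v \<le> f u"
proof (induction h arbitrary: v)
  case (Cons w h)
  show ?case
  proof (cases "\<forall>u\<in>set h. f u < f w")
    case True
    then show ?thesis using Cons.prems by force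
  next
    case False
    then obtain u where "u \<in> set h" "f w \<le> f u" by (auto simp: not_less)
    moreover have "v = w \<or> v \<in> set h" using Cons.prems by simp
    ultimately obtain u' where "u' \<in> set h" "f v \<le> f u'" by blast
    then show ?thesis using Cons.IH False by (auto intro: order_trans)
  qed
qed simp

lemma accepted_is_record:
  assumes "e \<in> set (accepted f h)"
  shows "\<exists>h1 h2. h = h2 @ e # h1 \<and> (\<forall>u\<in>set h1. f u < f e)"
  using assms
proof (induction h)
  case (Cons w h)
  show ?case
  proof (cases "e \<in> set (accepted f h)")
    case True
    with Cons.IH obtain h1 h2 where "h = h2 @ e # h1 \<and> (\<forall>u\<in>set h1. f u < f e)" by blast
    then have "w # h = (w # h2) @ e # h1 \<and> (\<forall>u\<in>set h1. f u < f e)" by simp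
    then show ?thesis by blast
  next
    case False
    with Cons.prems have "e = w" "\<forall>v\<in>set h. f v < f w" by (auto split: if_splits)
    then have "w # h = [] @ e # h \<and> (\<forall>u\<in>set h. f u < f e)" by simp
    then show ?thesis by blast
  qed
qed simp

text \<open>Jobs accepted after \<open>v\<close> have strictly increasing indices above
  \<open>f v\<close>. The indices are integers bounded by \<open>f v + 1\<close>, so there is room
  for one such job.\<close>

lemma accepted_append_short:
  assumes "v \<in> set h0" "\<forall>u\<in>set h2. f u \<le> f v + 1"
  shows "\<exists>X. accepted f (h2 @ h0) = X @ accepted f h0 \<and>
           (X = [] \<or> (\<exists>e\<in>set h2. X = [e] \<and> f v < f e))"
  using assms(2)
proof (induction h2)
  case (Cons w h2)
  then obtain X where X: "accepted f (h2 @ h0) = X @ accepted f h0"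
    "X = [] \<or> (\<exists>e\<in>set h2. X = [e] \<and> f v < f e)" by auto
  show ?case
  proof (cases "\<forall>u\<in>set (h2 @ h0). f u < f w")
    case True
    then have "f v < f w" using assms(1) by auto
    have "X = []"
    proof (rule ccontr)
      assume "X \<noteq> []"
      then obtain e where "e \<in> set h2" "f v < f e" using X(2) by blast
      moreover have "f e < f w" using True \<open>e \<in> set h2\<close> by simp
      moreover have "f w \<le> f v + 1" using Cons.prems by simp
      ultimately show False by linarith
    qed
    then show ?thesis using True X(1) \<open>f v < f w\<close> by auto
  next
    case False
    then show ?thesis using X by (auto simp del: set_append)
  qed
qed simp

section \<open>Charging an offline solution to the first machine\<close>

text \<open>The part of an offline solution \<open>A\<close> that has to be charged to the first machine.\<close>

lemma charge_exists:
  fixes A :: "real multiset"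
  assumes A: "A \<subseteq># mset h" "A \<noteq> {#}"
    and b: "\<And>a. a \<in># A \<Longrightarrow> b \<le> a" "b \<in># A"
    and hit: "sum_mset (A \<inter># mset (accepted f h)) \<le> l"
    and miss: "A \<inter># mset (accepted f h) = {#} \<Longrightarrow> b \<le> l"
  shows "\<exists>B. B \<subseteq># mset (rejected f h) \<and> size B < size A \<and> sum_mset A - l \<le> sum_mset B"
proof (cases "A \<inter># mset (accepted f h) = {#}")
  case True
  \<comment> \<open>All of \<open>A\<close> survives to the next machine, but the benchmark must
    shrink because one machine fewer remains. Giving up the smallest job \<open>b\<close> is the
    cheapest way.\<close>
  let ?B = "A - {#b#}"
  have "A - mset (accepted f h) = A"
    using True by (metis diff_intersect_right_idem inter_mset_def multiset_inter_commute
        diff_empty)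
  moreover have "A - mset (accepted f h) \<subseteq># mset (rejected f h)"
    using A(1) mset_accepted_rejected[of h f] by (simp add: subset_eq_diff_conv add.commute)
  ultimately have "?B \<subseteq># mset (rejected f h)"
    by (metis diff_subset_eq_self subset_mset.order_trans)
  moreover have "size ?B < size A" using b(2) by (metis insert_DiffM lessI size_add_mset)
  moreover have "sum_mset A = b + sum_mset ?B" using b(2) by (metis insert_DiffM sum_mset.add_mset)
  ultimately show ?thesis using miss[OF True] by (intro exI[of _ ?B]) auto
next
  case False
  \<comment> \<open>At least one job of \<open>A\<close> is accepted, so removing the accepted ones
    already makes the benchmark smaller.\<close>
  let ?B = "A - mset (accepted f h)"
  have eq: "A = (A \<inter># mset (accepted f h)) + ?B"
    by (metis add.commute diff_intersect_left_idem subset_mset.diff_add subset_mset.inf.cobounded1)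
  have "?B \<subseteq># mset (rejected f h)"
    using A(1) mset_accepted_rejected[of h f] by (simp add: subset_eq_diff_conv add.commute)
  moreover have "size A = size (A \<inter># mset (accepted f h)) + size ?B"
    using eq by (metis size_union)
  then have "size ?B < size A" using False by (simp add: nonempty_has_size)
  moreover have "sum_mset A = sum_mset (A \<inter># mset (accepted f h)) + sum_mset ?B"
    using eq by (metis sum_mset.union)
  ultimately show ?thesis using hit by (intro exI[of _ ?B]) auto
qed

text \<open>After the record \<open>v\<close>, whose index is at most one below the maximum, at most one further job is
  accepted, and no job up to \<open>v\<close> belongs to \<open>A\<close>.\<close>

lemma hit_le_mx:
  fixes A :: "real multiset"
  assumes A: "A \<subseteq># mset h"
    and b: "\<And>a. a \<in># A \<Longrightarrow> b \<le> a"
    and h: "h = h2 @ v # h1" "\<forall>u\<in>set h1. u < v" "v < b"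
    and f: "\<forall>u\<in>set h. f u \<le> f v + 1"
  shows "sum_mset (A \<inter># mset (accepted f h)) \<le> mx h"
proof -
  let ?C = "A \<inter># mset (accepted f h)"
  obtain X where X: "accepted f h = X @ accepted f (v # h1)"
    "X = [] \<or> (\<exists>e\<in>set h2. X = [e] \<and> f v < f e)"
    using accepted_append_short[of v "v # h1" h2 f] f h(1) by auto
  have small: "x < b" if "x \<in> set (accepted f (v # h1))" for x
    using subsetD[OF set_accepted that] h by auto
  \<comment> \<open>Jobs of \<open>A\<close> are at least \<open>b\<close>, whereas everything
    accepted up to \<open>v\<close> is below \<open>b\<close>; hence the common part fits into
    \<open>X\<close>, which has at most one entry.\<close>
  have C_eq: "?C = filter_mset (\<lambda>x. b \<le> x) ?C"
    using b by (intro filter_mset_eq_conv[THEN iffD2, symmetric]) auto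
  also have "\<dots> \<subseteq># filter_mset (\<lambda>x. b \<le> x) (mset (accepted f h))"
    by (intro multiset_filter_mono) simp
  also have "filter_mset (\<lambda>x. b \<le> x) (mset (accepted f h)) = filter_mset (\<lambda>x. b \<le> x) (mset X)"
  proof -
    have "filter (\<lambda>x. b \<le> x) (accepted f (v # h1)) = []"
      using small by (metis filter_False not_le)
    then have "filter_mset (\<lambda>x. b \<le> x) (mset (accepted f (v # h1))) = {#}"
      by (metis mset.simps(1) mset_filter)
    then show ?thesis using X(1) by (simp del: accepted.simps)
  qed
  also have "\<dots> \<subseteq># mset X" by simp
  finally have sub: "?C \<subseteq># mset X" .
  have "?C = {#} \<or> (\<exists>e\<in>set h. ?C = {#e#})"
  proof (cases "X = []")
    case True
    then show ?thesis using sub by simp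
  next
    case False
    then obtain e where e: "e \<in> set h" "X = [e]" using X(2) h(1) by auto
    have "size ?C \<le> 1" using size_mset_mono[OF sub] e by simp
    moreover have "a = e" if "a \<in># ?C" for a
      using mset_subset_eqD[OF sub that] e by simp
    ultimately show ?thesis
      using e(1) by (cases ?C) (auto simp: le_Suc_eq)
  qed
  then show ?thesis using mx_nonneg[of h] mx_ge[of _ h] by auto
qed

lemma accepted_nonneg: "\<forall>w\<in>set h. 0 < w \<Longrightarrow> 0 \<le> sum_list (accepted f h)"
  using set_accepted[of f h] by (intro sum_list_nonneg) force

lemma hit_le_accepted:
  fixes A :: "real multiset"
  assumes pos: "\<forall>w\<in>set h. 0 < w"
  shows "sum_mset (A \<inter># mset (accepted f h)) \<le> sum_list (accepted f h)"
proof -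
  let ?C = "A \<inter># mset (accepted f h)"
  obtain D where D: "mset (accepted f h) = ?C + D"
    by (metis subset_mset.inf.cobounded2 subset_mset.le_iff_add)
  have "x > 0" if "x \<in># D" for x
    using that D pos set_accepted[of f h]
    by (metis in_mono mset_subset_eqD mset_subset_eq_add_right set_mset_mset)
  then have "0 \<le> sum_mset D"
    by (induction D) (auto intro: add_nonneg_nonneg less_imp_le)
  moreover have "sum_list (accepted f h) = sum_mset ?C + sum_mset D"
    using D by (metis sum_mset.union sum_mset_sum_list)
  ultimately show ?thesis by linarith
qed

text \<open>Some job \<open>e\<close> with at least the index of the maximum is accepted. Its index
  exceeds that of \<open>a\<close>, so monotonicity gives \<open>e > a\<close>, and \<open>e\<close>
  is a record in size because it is one in index. The hypothesis on records then yields
  \<open>b \<le> e\<close>.\<close>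

lemma miss_le_accepted:
  assumes pos: "\<forall>w\<in>set h. 0 < w" and "h \<noteq> []"
    and no_record: "\<And>h1 v h2. h = h2 @ v # h1 \<Longrightarrow> \<forall>u\<in>set h1. u < v \<Longrightarrow> a \<le> v \<Longrightarrow> b \<le> v"
    and f: "mono_on {0<..} f" "0 < a" "f a < f (mx h)"
  shows "b \<le> sum_list (accepted f h)"
proof -
  have less: "u < v" if "0 < u" "0 < v" "f u < f v" for u v
    using mono_onD[OF f(1), of v u] that by force
  obtain e where e: "e \<in> set (accepted f h)" "f (mx h) \<le> f e"
    using accepted_dominates[OF mx_in_set, of h f] assms(1,2) by auto
  obtain h1 h2 where h: "h = h2 @ e # h1" "\<forall>u\<in>set h1. f u < f e"
    using accepted_is_record[OF e(1)] by blast
  have "0 < e" using h(1) pos by simp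
  have "\<forall>u\<in>set h1. u < e" using less[of _ e] h pos \<open>0 < e\<close> by auto
  moreover have "a \<le> e" using less[of a e] \<open>0 < e\<close> e(2) f(2,3) by linarith
  ultimately have "b \<le> e" using no_record h(1) by blast
  also have "e \<le> sum_list (accepted f h)"
    using e(1) pos set_accepted[of f h] by (intro member_le_sum_list) force+
  finally show ?thesis .
qed

section \<open>Rewards additive over the jobs and their expectations\<close>

text \<open>Recording only the jobs that enter an index above that of a fixed level \<open>a\<close> makes the reward
  of a machine additive over the jobs; for \<open>a = mx h / c\<close> exactly the reward is obtained.\<close>

fun reward_above :: "(real \<Rightarrow> int) \<Rightarrow> real \<Rightarrow> real list \<Rightarrow> real" where
  "reward_above f a [] = 0"
| "reward_above f a (w # h) = reward_above f a h + (if f (max a (mx h)) < f w then w else 0)"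

lemma reward_above_zero:
  assumes "mono_on {0<..} f" "0 < a" "\<forall>v\<in>set h. 0 < v" "\<forall>v\<in>set h. f v \<le> f a"
  shows "reward_above f a h = 0"
  using assms(3,4)
proof (induction h)
  case (Cons w h)
  have "f a \<le> f (max a (mx h))" using mono_onD[OF assms(1)] assms(2) by auto
  with Cons show ?case by auto
qed simp

text \<open>With indices at most one above \<open>f a\<close>, only one job can be counted: when
  \<open>w\<close> is counted, all earlier indices are at most \<open>f a\<close>, so nothing was
  counted before and \<open>w\<close> is accepted.\<close>

lemma reward_above_le:
  assumes "mono_on {0<..} f" "0 < a" "\<forall>v\<in>set h. 0 < v" "\<forall>v\<in>set h. f v \<le> f a + 1"
  shows "reward_above f a h \<le> mx (accepted f h)"
  using assms(3,4)
proof (induction h)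
  case (Cons w h)
  show ?case
  proof (cases "f (max a (mx h)) < f w")
    case True
    have le: "f a \<le> f (max a (mx h))" using mono_onD[OF assms(1)] assms(2) by auto
    have le': "f v \<le> f (max a (mx h))" if "v \<in> set h" for v
      using mono_onD[OF assms(1)] Cons.prems that mx_ge[OF that] assms(2) by (simp add: le_max_iff_disj)
    have "\<forall>v\<in>set h. f v \<le> f a" using le' le True Cons.prems by fastforce
    then have "reward_above f a h = 0"
      using reward_above_zero[OF assms(1,2)] Cons.prems by simp
    moreover have "\<forall>v\<in>set h. f v < f w" using le' True by fastforce
    ultimately show ?thesis using True by simp
  next
    case False
    then show ?thesis using Cons by (auto simp: le_max_iff_disj)
  qed
qed simp

text \<open>\<open>log_gain a h\<close> is \<open>ln c\<close> times the expectation of \<^term>\<open>reward_above\<close>, and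
  \<open>exp_accepted c h\<close> is the expected total size of the accepted jobs.\<close>

fun log_gain :: "real \<Rightarrow> real list \<Rightarrow> real" where
  "log_gain a [] = 0"
| "log_gain a (w # h) =
     log_gain a h + (if w \<le> max a (mx h) then 0 else w * ln (w / max a (mx h)))"

text \<open>Two points at distance \<open>log c (w / a)\<close> on the logarithmic scale are
  separated by a uniformly shifted unit grid with this probability.\<close>

definition pass_prob :: "real \<Rightarrow> real \<Rightarrow> real \<Rightarrow> real" where
  "pass_prob c a w = (if w \<le> a then 0 else min 1 (log c (w / a)))"

fun exp_accepted :: "real \<Rightarrow> real list \<Rightarrow> real" where
  "exp_accepted c [] = 0"
| "exp_accepted c (w # h) =
     exp_accepted c h + w * (if h = [] then 1 else pass_prob c (mx h) w)"

section \<open>Deterministic inequalities between gain and accepted size\<close>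

lemma mult_ln_ratio_ge:
  fixes w m :: real
  assumes "0 < m" "0 < w"
  shows "w - m \<le> w * ln (w / m)"
proof -
  have "ln (m / w) \<le> m / w - 1" using assms by (intro ln_le_minus_one) simp
  then have "w * ln (m / w) \<le> w * (m / w - 1)"
    using assms by (intro mult_left_mono) auto
  then show ?thesis using assms by (simp add: ln_div algebra_simps)
qed

lemma log_gain_nonneg: "0 < a \<Longrightarrow> 0 \<le> log_gain a h"
  by (induction h) (auto simp: max_def intro!: add_nonneg_nonneg mult_nonneg_nonneg ln_ge_zero)

text \<open>By \<open>mult_ln_ratio_ge\<close> every counted job contributes at least its increase
  over the previous level, and these increases telescope.\<close>

lemma log_gain_ge: "0 < a \<Longrightarrow> mx h - a \<le> log_gain a h"
proof (induction h)
  case (Cons w h)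
  have "w - max a (mx h) \<le> w * ln (w / max a (mx h))" if "w > max a (mx h)"
    using that Cons.prems by (intro mult_ln_ratio_ge) auto
  with Cons log_gain_nonneg[of a h] show ?case by (auto simp: max_def split: if_splits)
qed simp

lemma log_gain_zero: "\<forall>w\<in>set h. w \<le> a \<Longrightarrow> log_gain a h = 0"
  by (induction h) auto

text \<open>Convexity of \<open>- ln\<close>: on \<open>[1/c, 1]\<close> the function lies below its chord.\<close>

lemma ln_chord:
  fixes c t :: real
  assumes "1 < c" "1 \<le> t" "t \<le> c"
  shows "ln t \<le> (beta c + 1) * (1 - 1 / t)"
proof -
  \<comment> \<open>The weight for which \<open>1 / t\<close> is the convex combination of 1 and
    \<open>1 / c\<close>. The chord of \<open>- ln\<close> over these two points has slope of
    absolute value \<open>c * ln c / (c - 1) = beta c + 1\<close>.\<close>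
  define l where "l = (1 - 1 / t) * (c / (c - 1))"
  have l: "0 \<le> l" "l \<le> 1"
    using assms by (auto simp: l_def field_simps)
  have 1: "1 / t = (1 - l) * 1 + l * (1 / c)"
  proof -
    have "(c / (c - 1)) * (1 - 1 / c) = 1" using assms by (simp add: field_simps)
    then have "l * (1 - 1 / c) = 1 - 1 / t"
      unfolding l_def mult.assoc by (simp only: mult_1_right)
    then show ?thesis by (simp add: algebra_simps)
  qed
  have "convex_on {0<..} (\<lambda>x::real. - ln x)"
    using minus_log_convex[of "exp 1"] by (simp add: log_def)
  then have "- ln (1 / t) \<le> (1 - l) * (- ln 1) + l * (- ln (1 / c))"
    unfolding 1 using l assms
      convex_onD[of "{0<..}" "\<lambda>x::real. - ln x" l 1 "1 / c"] by simp
  then have "ln t \<le> l * ln c" using assms by (simp add: ln_div)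
  also have "\<dots> = (beta c + 1) * (1 - 1 / t)"
    by (simp add: l_def beta_def)
  finally show ?thesis .
qed

lemma beta_chord: "1 < c \<Longrightarrow> (beta c + 1) * (1 - 1 / c) = ln c"
  by (simp add: beta_def field_simps)

lemma beta_pos: assumes "1 < c" shows "0 < beta c"
proof -
  have "ln (1 / c) < 1 / c - 1"
    using ln_le_minus_one[of "1 / c"] ln_eq_minus_one[of "1 / c"] assms by fastforce
  then show ?thesis using assms by (simp add: beta_def ln_div field_simps)
qed

text \<open>Induction on the jobs: a new maximum \<open>w\<close> over the old maximum
  \<open>m\<close> adds at most \<open>(beta c + 1) * (w - m)\<close> to the left side. For
  \<open>w \<le> c * m\<close> this is the chord bound; for larger \<open>w\<close> the added
  \<open>w * ln c\<close> equals \<open>(beta c + 1) * (w - w / c)\<close>, and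
  \<open>m < w / c\<close>.\<close>

lemma exp_accepted_le:
  assumes c: "1 < c" and pos: "\<forall>w\<in>set h. 0 < w"
  shows "exp_accepted c h * ln c \<le> (beta c + 1) * mx h"
  using pos
proof (induction h)
  case (Cons w h)
  have K: "ln c \<le> beta c + 1" "0 < beta c" using ln_chord[of c c] beta_pos[of c] c
    by (auto simp: beta_def field_simps)
  show ?case
  proof (cases "h = []")
    case True
    then show ?thesis using K Cons.prems by (simp add: max_def mult.commute mult_left_mono)
  next
    case False
    define m where "m = mx h"
    have m: "0 < m" using mx_pos False Cons.prems by (simp add: m_def)
    have IH: "exp_accepted c h * ln c \<le> (beta c + 1) * m" using Cons by (simp add: m_def)
    have "0 < w" using Cons.prems by simp
    consider "w \<le> m" | "m < w" "w \<le> c * m" | "c * m < w" by linarith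
    then show ?thesis
    proof cases
      case 1
      then show ?thesis using IH False by (simp add: pass_prob_def m_def)
    next
      case 2
      have "ln (w / m) \<le> (beta c + 1) * (1 - 1 / (w / m))"
        using 2 m c by (intro ln_chord) (auto simp: field_simps)
      then have "w * ln (w / m) \<le> w * ((beta c + 1) * (1 - 1 / (w / m)))"
        using \<open>0 < w\<close> by (intro mult_left_mono) auto
      also have "\<dots> = (beta c + 1) * (w - m)" using \<open>0 < w\<close> by (simp add: field_simps)
      finally have "(beta c + 1) * m + w * ln (w / m) \<le> (beta c + 1) * w"
        by (simp add: algebra_simps)
      moreover have "log c (w / m) \<le> 1"
        using 2 m c by (simp add: field_simps)
      then have "pass_prob c m w * ln c = ln (w / m)"
        using 2 c by (simp add: pass_prob_def log_def)
      ultimately show ?thesis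
        using IH False 2 m by (simp add: m_def[symmetric] algebra_simps)
    next
      case 3
      have "pass_prob c m w \<le> 1" by (simp add: pass_prob_def)
      then have "w * pass_prob c m w * ln c \<le> w * 1 * ln c"
        using \<open>0 < w\<close> c by (intro mult_right_mono mult_left_mono) auto
      moreover have "(beta c + 1) * m \<le> (beta c + 1) * (w / c)"
        using 3 c K by (intro mult_left_mono) (auto simp: field_simps)
      moreover have "(beta c + 1) * (w / c) + w * ln c = (beta c + 1) * w"
      proof -
        have "w * ((beta c + 1) * (1 - 1 / c)) = w * ln c" using beta_chord[OF c] by simp
        then show ?thesis by (simp add: algebra_simps)
      qed
      moreover have "m < w" using 3 c m by (smt (verit) mult_less_cancel_right2)
      ultimately show ?thesis
        using IH False by (simp add: m_def[symmetric] algebra_simps)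
    qed
  qed
qed simp

text \<open>Generalized from the level \<open>a = mx h / c\<close>, where the left side vanishes, so
  that induction on the jobs applies. If the old maximum \<open>m\<close> exceeds \<open>a\<close>,
  a new maximum \<open>w\<close> adds \<open>w * ln (w / m)\<close> to both the gain and the scaled
  accepted size, a net \<open>(1 - \<eta>) * w * ln (w / m)\<close>, which is at least
  \<open>(1 - \<eta>) * (w - m)\<close>. If \<open>m \<le> a\<close>, the gain is the single term
  \<open>w * ln (w / a)\<close> and \<open>exp_accepted_le\<close> bounds the rest directly.\<close>

lemma log_gain_vs_exp_accepted:
  assumes c: "1 < c" and \<eta>: "0 \<le> \<eta>" "\<eta> < 1" "\<eta> * beta c = ln c + ln (1 - \<eta>)"
    and pos: "\<forall>w\<in>set h. 0 < w" and "h \<noteq> []" and a: "mx h / c \<le> a" "a \<le> mx h"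
  shows "(1 - \<eta>) * (mx h - a * c) \<le> log_gain a h - \<eta> * (exp_accepted c h * ln c)"
  using pos \<open>h \<noteq> []\<close> a
proof (induction h)
  case (Cons w h)
  have "0 < w" using Cons.prems by simp
  have K: "0 < beta c" using beta_pos[OF c] .
  have "0 < a" using Cons.prems c mx_pos[of "w # h"]
    by (smt (verit) divide_pos_pos)
  have full: "?case" if "mx h \<le> a" "mx h < w"
  proof -
    have "\<eta> * (exp_accepted c (w # h) * ln c) \<le> \<eta> * ((beta c + 1) * mx (w # h))"
      using exp_accepted_le[OF c Cons.prems(1)] \<eta> by (intro mult_left_mono)
    also have "\<dots> = \<eta> * (beta c + 1) * w" using that by simp
    also have "\<dots> = w * (ln c + ln (1 - \<eta>) + \<eta>)"
      using \<eta>(3) by (simp add: algebra_simps)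
    finally have 1: "\<eta> * (exp_accepted c (w # h) * ln c) \<le> w * (ln c + ln (1 - \<eta>) + \<eta>)" .
    have "\<forall>v\<in>set h. v \<le> a" using that mx_ge by fastforce
    then have 2: "log_gain a (w # h) = w * ln (w / a)"
      using that Cons.prems \<open>0 < a\<close> by (simp add: log_gain_zero max_def)
    \<comment> \<open>The reference point \<open>(1 - \<eta>) * c * a\<close> is chosen so that its
      logarithm produces exactly the term \<open>ln c + ln (1 - \<eta>)\<close> coming from the
      equation for \<open>\<eta>\<close>.\<close>
    have "w - (1 - \<eta>) * c * a \<le> w * ln (w / ((1 - \<eta>) * c * a))"
      using \<open>0 < w\<close> \<open>0 < a\<close> \<eta> c by (intro mult_ln_ratio_ge) auto
    also have "ln (w / ((1 - \<eta>) * c * a)) = ln (w / a) - ln c - ln (1 - \<eta>)"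
      using \<open>0 < w\<close> \<open>0 < a\<close> \<eta> c by (simp add: ln_div ln_mult)
    finally have "w - (1 - \<eta>) * c * a \<le> w * ln (w / a) - w * (ln c + ln (1 - \<eta>))"
      by (simp add: algebra_simps)
    then show ?thesis using 1 2 that by (simp add: algebra_simps)
  qed
  show ?case
  proof (cases "h = []")
    case True
    then show ?thesis using full \<open>0 < w\<close> \<open>0 < a\<close> by simp
  next
    case False
    define m where "m = mx h"
    have m: "0 < m" using mx_pos False Cons.prems by (simp add: m_def)
    show ?thesis
    proof (cases "w \<le> m")
      case True
      then show ?thesis using Cons False by (simp add: m_def pass_prob_def)
    next
      case w: False
      show ?thesis
      proof (cases "m \<le> a")
        case True
        then show ?thesis using full w by (simp add: m_def)
      next
        case am: False
        have "m / c \<le> a" using Cons.prems(3) w c by (simp add: m_def field_simps)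
        then have IH: "(1 - \<eta>) * (m - a * c) \<le> log_gain a h - \<eta> * (exp_accepted c h * ln c)"
          using Cons False am by (simp add: m_def)
        have "w \<le> a * c" using Cons.prems(3) w c by (simp add: m_def field_simps)
        also have "\<dots> \<le> m * c" using am c by (intro mult_right_mono) auto
        finally have "w / m \<le> c" using m by (simp add: field_simps)
        then have "pass_prob c m w * ln c = ln (w / m)"
          using w c m \<open>0 < w\<close> by (simp add: pass_prob_def log_def)
        moreover have "log_gain a (w # h) = log_gain a h + w * ln (w / m)"
          using am w by (simp add: m_def)
        moreover have "(1 - \<eta>) * (w - m) \<le> (1 - \<eta>) * (w * ln (w / m))"
          using mult_ln_ratio_ge[OF m \<open>0 < w\<close>] \<eta> by (intro mult_left_mono) auto
        ultimately show ?thesis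
          using IH w False by (simp add: m_def[symmetric] algebra_simps)
      qed
    qed
  qed
qed simp

corollary exp_accepted_le_log_gain:
  assumes "1 < c" "0 \<le> \<eta>" "\<eta> < 1" "\<eta> * beta c = ln c + ln (1 - \<eta>)"
    and "\<forall>w\<in>set h. 0 < w" and "h \<noteq> []"
  shows "\<eta> * (exp_accepted c h * ln c) \<le> log_gain (mx h / c) h"
  using log_gain_vs_exp_accepted[OF assms, of "mx h / c"] assms(1)
    mult_right_mono[of 1 c "mx h"] mx_nonneg[of h]
  by (simp add: field_simps)

section \<open>Interval indices under a uniform offset\<close>

abbreviation offset_measure :: "real measure" where
  "offset_measure \<equiv> uniform_measure lborel {0<..1}"

lemma prob_space_offset_measure: "prob_space offset_measure"
  by (intro prob_space_uniform_measure) auto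

text \<open>The intervals are open on the left and closed on the right, hence a ceiling minus one
  rather than a floor.\<close>

lemma interval_index_eq:
  assumes "1 < c" "0 < w"
  shows "interval_index c y w = \<lceil>log c w - y\<rceil> - 1"
  unfolding interval_index_def
proof (rule the_equality)
  have *: "w \<in> {c powr (of_int k + y) <.. c powr (of_int k + 1 + y)} \<longleftrightarrow>
      of_int k < log c w - y \<and> log c w - y \<le> of_int k + 1" for k :: int
    using less_log_iff[OF assms, of "of_int k + y"] log_le_iff[OF assms, of "of_int k + 1 + y"]
    by auto
  show "w \<in> {c powr (of_int (\<lceil>log c w - y\<rceil> - 1) + y) <.. c powr (of_int (\<lceil>log c w - y\<rceil> - 1) + 1 + y)}"
    unfolding * by linarith
  fix k :: int
  assume "w \<in> {c powr (of_int k + y) <.. c powr (of_int k + 1 + y)}"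
  then show "k = \<lceil>log c w - y\<rceil> - 1" unfolding * by linarith
qed

lemma interval_index_mono:
  assumes "1 < c"
  shows "mono_on {0<..} (interval_index c y)"
proof (rule mono_onI)
  fix v w :: real
  assume "v \<in> {0<..}" "w \<in> {0<..}" "v \<le> w"
  then have "\<lceil>log c v - y\<rceil> \<le> \<lceil>log c w - y\<rceil>"
    using assms by (intro ceiling_mono) simp
  then show "interval_index c y v \<le> interval_index c y w"
    using assms \<open>v \<in> {0<..}\<close> \<open>w \<in> {0<..}\<close> by (simp add: interval_index_eq)
qed

lemma interval_index_le_add_one:
  assumes "1 < c" "0 < v" "0 < w" "w \<le> c * v"
  shows "interval_index c y w \<le> interval_index c y v + 1"
proof -
  have "log c w \<le> log c (c * v)" using assms by simp
  also have "\<dots> = log c v + 1" using assms by (simp add: log_mult)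
  finally show ?thesis using assms by (simp add: interval_index_eq) linarith
qed

lemma interval_index_div: "1 < c \<Longrightarrow> 0 < w \<Longrightarrow> interval_index c y (w / c) = interval_index c y w - 1"
  by (simp add: interval_index_eq log_divide) linarith

text \<open>Rounding after a uniform shift is unbiased: almost surely the ceiling exceeds the floor
  of \<open>A\<close> by one if \<open>y\<close> is below the fractional part \<theta> of
  \<open>A\<close>, and equals it otherwise.\<close>

lemma expectation_ceiling:
  "has_bochner_integral offset_measure (\<lambda>y. of_int \<lceil>A - y\<rceil>) (A::real)"
proof -
  interpret prob_space offset_measure by (rule prob_space_offset_measure)
  define \<theta> where "\<theta> = A - of_int \<lfloor>A\<rfloor>"
  have \<theta>: "0 \<le> \<theta>" "\<theta> < 1" by (simp_all add: \<theta>_def) linarith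
  have "measure offset_measure {..<\<theta>} = measure lborel ({0<..1} \<inter> {..<\<theta>})"
    by (simp add: measure_uniform_measure)
  also have "{0<..1} \<inter> {..<\<theta>} = {0<..<\<theta>}" using \<theta> by auto
  finally have \<theta>_eq: "measure offset_measure {..<\<theta>} = \<theta>" using \<theta> by simp
  have "has_bochner_integral offset_measure
      (\<lambda>y. of_int \<lfloor>A\<rfloor> + indicator {..<\<theta>} y :: real) (of_int \<lfloor>A\<rfloor> + \<theta>)"
    using \<theta>_eq
    by (intro has_bochner_integral_add)
      (auto simp: has_bochner_integral_iff prob_space emeasure_eq_measure)
  moreover have "AE y in offset_measure. of_int \<lceil>A - y\<rceil> = (of_int \<lfloor>A\<rfloor> + indicator {..<\<theta>} y :: real)"
  proof (rule AE_uniform_measureI)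
    \<comment> \<open>At \<open>y = 1\<close> the formula fails when \<open>A\<close> is an integer,
      so this null set is discarded.\<close>
    have "AE y in lborel. y \<noteq> (1::real)" by (rule AE_lborel_singleton)
    then show "AE y in lborel. y \<in> {0<..1} \<longrightarrow>
        of_int \<lceil>A - y\<rceil> = (of_int \<lfloor>A\<rfloor> + indicator {..<\<theta>} y :: real)"
    proof eventually_elim
      case (elim y)
      have "\<lceil>A - y\<rceil> = \<lfloor>A\<rfloor> + (if y < \<theta> then 1 else 0)" if "0 < y" "y \<le> 1"
        using that elim \<theta> unfolding \<theta>_def ceiling_eq_iff by (auto; linarith)
      then show ?case by auto
    qed
  qed simp
  ultimately show ?thesis
    by (subst has_bochner_integral_cong_AE[where g = "\<lambda>y. of_int \<lfloor>A\<rfloor> + indicator {..<\<theta>} y"])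
      (auto simp: \<theta>_def)
qed

text \<open>For \<open>a < w \<le> c * a\<close> the indices differ by 0 or 1, so the indicator is
  the difference of two ceilings, whose expectations are the logarithms.\<close>

lemma expectation_index_less:
  assumes "1 < c" "0 < a" "0 < w"
  shows "has_bochner_integral offset_measure
    (\<lambda>y. if interval_index c y a < interval_index c y w then 1 else 0) (pass_prob c a w)"
proof -
  interpret prob_space offset_measure by (rule prob_space_offset_measure)
  consider "w \<le> a" | "a < w" "w \<le> c * a" | "c * a < w" by linarith
  then show ?thesis
  proof cases
    case 1
    then have "\<not> interval_index c y a < interval_index c y w" for y
      using mono_onD[OF interval_index_mono[OF assms(1)], of w a y] assms by simp
    then show ?thesis using 1 by (simp add: pass_prob_def has_bochner_integral_zero)
  next
    case 2
    have "has_bochner_integral offset_measure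
        (\<lambda>y. of_int \<lceil>log c w - y\<rceil> - of_int \<lceil>log c a - y\<rceil>) (log c w - log c a)"
      by (intro has_bochner_integral_diff expectation_ceiling)
    moreover have "(of_int \<lceil>log c w - y\<rceil> - of_int \<lceil>log c a - y\<rceil> :: real) =
        (if interval_index c y a < interval_index c y w then 1 else 0)" for y
    proof -
      have "interval_index c y a \<le> interval_index c y w"
        using mono_onD[OF interval_index_mono[OF assms(1)], of a w y] assms 2 by simp
      moreover have "interval_index c y w \<le> interval_index c y a + 1"
        using interval_index_le_add_one assms 2 by simp
      ultimately show ?thesis using assms by (auto simp: interval_index_eq)
    qed
    moreover have "log c w - log c a = pass_prob c a w"
    proof -
      have "log c (w / a) \<le> 1" using 2 assms by (simp add: field_simps)
      then show ?thesis using 2 assms by (simp add: pass_prob_def log_divide)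
    qed
    ultimately show ?thesis by simp
  next
    case 3
    then have "a < w" using assms by (smt (verit) mult_less_cancel_right2)
    have "log c (c * a) < log c w" using 3 assms by simp
    then have "log c a + 1 < log c w" using assms by (simp add: log_mult)
    then have "interval_index c y a < interval_index c y w" for y
      using assms by (simp add: interval_index_eq) linarith
    moreover have "1 < log c w - log c a" using \<open>log c a + 1 < log c w\<close> by simp
    then have "pass_prob c a w = 1"
      using assms \<open>a < w\<close> by (simp add: pass_prob_def log_divide min_def)
    ultimately show ?thesis by (simp add: has_bochner_integral_iff prob_space)
  qed
qed

lemma expectation_accepted:
  assumes c: "1 < c" and pos: "\<forall>w\<in>set h. 0 < w"
  shows "has_bochner_integral offset_measure
    (\<lambda>y. sum_list (accepted (interval_index c y) h)) (exp_accepted c h)"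
  using pos
proof (induction h)
  case (Cons w h)
  interpret prob_space offset_measure by (rule prob_space_offset_measure)
  have "has_bochner_integral offset_measure
      (\<lambda>y. if \<forall>v\<in>set h. interval_index c y v < interval_index c y w then 1 else 0)
      (if h = [] then 1 else pass_prob c (mx h) w)"
  proof (cases "h = []")
    case True
    then show ?thesis by (simp add: has_bochner_integral_iff prob_space)
  next
    case False
    have m: "mx h \<in> set h" "0 < mx h" using mx_in_set mx_pos False Cons.prems by auto
    \<comment> \<open>Indices are monotone in the size, so only the largest earlier job
      matters.\<close>
    have "(\<forall>v\<in>set h. interval_index c y v < interval_index c y w) \<longleftrightarrow>
        interval_index c y (mx h) < interval_index c y w" for y
      using m mx_ge mono_onD[OF interval_index_mono[OF c], of _ "mx h" y] Cons.prems
      by (meson greaterThan_iff le_less_trans list.set_intros(2))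
    then show ?thesis using expectation_index_less[OF c m(2)] Cons.prems False by simp
  qed
  then have "has_bochner_integral offset_measure
      (\<lambda>y. sum_list (accepted (interval_index c y) h) +
        w * (if \<forall>v\<in>set h. interval_index c y v < interval_index c y w then 1 else 0))
      (exp_accepted c (w # h))"
    unfolding exp_accepted.simps using Cons
    by (intro has_bochner_integral_add has_bochner_integral_mult_right) simp_all
  then show ?case by (rule has_bochner_integral_cong[THEN iffD1, rotated -1]) auto
qed (simp add: has_bochner_integral_zero)

lemma expectation_reward_above:
  assumes c: "1 < c" and pos: "\<forall>w\<in>set h. 0 < w \<and> w \<le> c * a" and "0 < a"
  shows "has_bochner_integral offset_measure
    (\<lambda>y. reward_above (interval_index c y) a h) (log_gain a h / ln c)"
  using pos
proof (induction h)
  case (Cons w h)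
  let ?m = "max a (mx h)"
  have w: "0 < w" "w \<le> c * ?m" using Cons.prems c
    by (auto intro: order_trans mult_left_mono)
  \<comment> \<open>As \<open>w \<le> c * ?m\<close>, the cap at 1 in \<open>pass_prob\<close> is
    not exceeded, and the probability is a plain logarithm.\<close>
  have "w * pass_prob c ?m w = (if w \<le> ?m then 0 else w * ln (w / ?m)) / ln c"
  proof -
    have "w / ?m \<le> c" using w \<open>0 < a\<close> by (simp add: field_simps)
    then have "log c (w / ?m) \<le> 1" using c w \<open>0 < a\<close> by simp
    then show ?thesis by (simp add: pass_prob_def log_def)
  qed
  then have eq: "log_gain a (w # h) / ln c = log_gain a h / ln c + w * pass_prob c ?m w"
    by (simp add: add_divide_distrib)
  have "has_bochner_integral offset_measure
      (\<lambda>y. reward_above (interval_index c y) a h +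
        w * (if interval_index c y ?m < interval_index c y w then 1 else 0))
      (log_gain a (w # h) / ln c)"
    unfolding eq using Cons expectation_index_less[OF c, of ?m w] w \<open>0 < a\<close>
    by (intro has_bochner_integral_add has_bochner_integral_mult_right) auto
  then show ?case by (rule has_bochner_integral_cong[THEN iffD1, rotated -1]) auto
qed (simp add: has_bochner_integral_zero)

section \<open>Decomposition of the run into single machines\<close>

text \<open>The run seen machine by machine: each machine passes its rejected jobs on to the next one.\<close>

fun machine_reward :: "real \<Rightarrow> ('m \<Rightarrow> real) \<Rightarrow> 'm list \<Rightarrow> real list \<Rightarrow> 'm \<Rightarrow> real" where
  "machine_reward c x [] h u = 0"
| "machine_reward c x (v # ms) h u =
     (if u = v then mx (accepted (interval_index c (x v)) h)
      else machine_reward c x ms (rejected (interval_index c (x v)) h) u)"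

lemma machine_reward_nonneg: "0 \<le> machine_reward c x ms h u"
  by (induction ms arbitrary: h) (auto simp: mx_nonneg)

lemma machine_reward_fun_upd:
  "v \<notin> set ms \<Longrightarrow> machine_reward c (x(v := y)) ms h u = machine_reward c x ms h u"
  by (induction ms arbitrary: h) auto

lemma machine_reward_le: "machine_reward c x ms h u \<le> mx h"
proof (induction ms arbitrary: h)
  case (Cons v ms)
  have mono: "mx l \<le> mx h" if "set l \<subseteq> set h" for l
    using that unfolding mx_def by (intro Max_mono) auto
  show ?case
    using mono[OF set_accepted] order_trans[OF Cons.IH mono[OF set_rejected]] by simp
qed (simp add: mx_nonneg)

definition jobs_of :: "'m history \<Rightarrow> 'm \<Rightarrow> real set" where
  "jobs_of h u = {w. (w, Some u) \<in> set h}"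

lemma run_algorithm_snoc:
  "run_algorithm c x ms (ws @ [w]) =
     run_algorithm c x ms ws @ [(w, choose_machine c x ms (run_algorithm c x ms ws) w)]"
  by (simp add: run_algorithm_def)

lemma choose_machine_cong:
  "(\<And>u. u \<in> set ms \<Longrightarrow> jobs_of h u = jobs_of h' u) \<Longrightarrow>
     choose_machine c x ms h w = choose_machine c x ms h' w"
  unfolding choose_machine_def
  by (intro find_cong) (auto simp: blocked_def jobs_of_def set_eq_iff)

text \<open>Induction in order of arrival. The first machine is blocked exactly when
  \<open>accepted\<close> drops the job; the choice among the other machines depends only on their
  own jobs, so they behave as if only the rejected jobs had arrived.\<close>

lemma run_first_machine:
  fixes x :: "'m \<Rightarrow> real" and c :: real
  assumes "v \<notin> set ms"
  defines "f \<equiv> interval_index c (x v)"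
  shows "jobs_of (run_algorithm c x (v # ms) (rev h)) v = set (accepted f h) \<and>
    (\<forall>u\<in>set ms. jobs_of (run_algorithm c x (v # ms) (rev h)) u =
       jobs_of (run_algorithm c x ms (rev (rejected f h))) u)"
proof (induction h)
  case Nil
  show ?case by (simp add: run_algorithm_def jobs_of_def)
next
  case (Cons w h)
  let ?H = "run_algorithm c x (v # ms) (rev h)"
  let ?H' = "run_algorithm c x ms (rev (rejected f h))"
  have blocked_iff: "blocked c x ?H w v \<longleftrightarrow> \<not> (\<forall>u\<in>set h. f u < f w)"
  proof -
    have "blocked c x ?H w v \<longleftrightarrow> (\<exists>u\<in>jobs_of ?H v. f w \<le> f u)"
      by (auto simp: blocked_def jobs_of_def f_def)
    also have "\<dots> \<longleftrightarrow> (\<exists>u\<in>set (accepted f h). f w \<le> f u)" using Cons.IH by simp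
    also have "\<dots> \<longleftrightarrow> (\<exists>u\<in>set h. f w \<le> f u)"
      using accepted_dominates[of _ h f] set_accepted[of f h] by (meson order_trans subsetD)
    finally show ?thesis by (auto simp: not_less)
  qed
  have jobs_snoc: "jobs_of (l @ [(w, m)]) u = jobs_of l u \<union> (if m = Some u then {w} else {})"
    for l m and u :: 'm
    by (auto simp: jobs_of_def)
  show ?case
  proof (cases "\<forall>u\<in>set h. f u < f w")
    case True
    then have "choose_machine c x (v # ms) ?H w = Some v"
      using blocked_iff by (simp add: choose_machine_def)
    then show ?thesis using Cons.IH True assms(1) by (auto simp: run_algorithm_snoc jobs_snoc)
  next
    case False
    have "choose_machine c x (v # ms) ?H w = choose_machine c x ms ?H w"
      using blocked_iff False by (simp add: choose_machine_def)
    also have "\<dots> = choose_machine c x ms ?H' w"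
      using Cons.IH by (intro choose_machine_cong) auto
    finally have eq: "choose_machine c x (v # ms) ?H w = choose_machine c x ms ?H' w" .
    have "choose_machine c x ms ?H' w \<noteq> Some v"
      using assms(1) by (auto simp: choose_machine_def find_Some_iff)
    then show ?thesis using Cons.IH False assms(1)
      by (auto simp: run_algorithm_snoc jobs_snoc eq)
  qed
qed

lemma machine_reward_run:
  "distinct ms \<Longrightarrow> u \<in> set ms \<Longrightarrow>
     Max (insert 0 (jobs_of (run_algorithm c x ms (rev h)) u)) = machine_reward c x ms h u"
proof (induction ms arbitrary: h)
  case (Cons v ms)
  then show ?case using run_first_machine[of v ms c x h] by (auto simp: mx_def)
qed simp

lemma total_reward_run:
  assumes "distinct ms"
  shows "total_reward (set ms) s (run_algorithm c x ms ws) =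
    (\<Sum>u\<in>set ms. s u * machine_reward c x ms (rev ws) u)"
  unfolding total_reward_def
  using machine_reward_run[OF assms, of _ c x "rev ws"] by (simp add: jobs_of_def)

section \<open>The offline benchmark and summation by parts\<close>

text \<open>Take the largest job of every machine in \<open>U\<close> that has one. Different
  machines use different entries of the history, so multiplicities are respected even for equal
  sizes.\<close>

lemma offline_submultiset:
  fixes H :: "'m history"
  assumes "finite U" "\<forall>p\<in>set H. 0 < fst p"
  shows "\<exists>A. A \<subseteq># image_mset fst (filter_mset (\<lambda>p. snd p \<in> Some ` U) (mset H)) \<and>
    size A \<le> card U \<and> sum_mset A = (\<Sum>u\<in>U. Max (insert 0 (jobs_of H u)))"
  using assms(1)
proof induction
  case empty
  show ?case by (intro exI[of _ "{#}"]) simp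
next
  case (insert u U)
  let ?on = "\<lambda>U. image_mset fst (filter_mset (\<lambda>p. snd p \<in> Some ` U) (mset H))"
  obtain A where A: "A \<subseteq># ?on U" "size A \<le> card U"
    "sum_mset A = (\<Sum>u\<in>U. Max (insert 0 (jobs_of H u)))"
    using insert.IH by blast
  have on_insert: "?on (insert u U) = ?on {u} + ?on U"
  proof -
    have "filter_mset (\<lambda>p. snd p \<in> Some ` insert u U) M =
        filter_mset (\<lambda>p. snd p \<in> Some ` {u}) M + filter_mset (\<lambda>p. snd p \<in> Some ` U) M"
      for M :: "(real \<times> 'm option) multiset"
      using insert.hyps(2) by (induction M) auto
    then show ?thesis by (metis image_mset_union)
  qed
  have fin: "finite (jobs_of H u)"
  proof (rule finite_subset)
    show "jobs_of H u \<subseteq> fst ` set H" by (force simp: jobs_of_def)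
  qed simp
  show ?case
  proof (cases "jobs_of H u = {}")
    case True
    have "A \<subseteq># ?on (insert u U)"
      unfolding on_insert by (rule subset_mset.order_trans[OF A(1)]) simp
    then show ?thesis using A insert.hyps True by (intro exI[of _ A]) auto
  next
    case False
    let ?w = "Max (jobs_of H u)"
    have w: "(?w, Some u) \<in> set H" using Max_in[OF fin False] by (simp add: jobs_of_def)
    then have "?w \<in># ?on {u}" by force
    then have "{#?w#} + A \<subseteq># ?on (insert u U)"
      unfolding on_insert using A(1) by (intro subset_mset.add_mono) (simp_all add: mset_subset_eq_single)
    moreover have "0 < ?w" using assms(2) w by fastforce
    then have "Max (insert 0 (jobs_of H u)) = ?w"
      using fin False by simp
    ultimately show ?thesis using A insert.hyps by (intro exI[of _ "add_mset ?w A"]) auto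
  qed
qed

lemma weighted_sum_mono:
  fixes s p q :: "'m \<Rightarrow> real"
  assumes "sorted_wrt (\<lambda>u v. s u \<ge> s v) ms" "distinct ms" "\<forall>u\<in>set ms. 0 \<le> s u"
    and "\<And>k. k \<le> length ms \<Longrightarrow> (\<Sum>u\<in>set (take k ms). q u) \<le> (\<Sum>u\<in>set (take k ms). p u)"
  shows "(\<Sum>u\<in>set ms. s u * q u) \<le> (\<Sum>u\<in>set ms. s u * p u)"
proof -
  \<comment> \<open>Stated for any lower bound \<open>t\<close> on the speeds: after splitting off
    the last and slowest machine \<open>v\<close>, the induction hypothesis is used with
    \<open>t = s v\<close>.\<close>
  have gen: "t * (\<Sum>u\<in>set ms. p u - q u) \<le> (\<Sum>u\<in>set ms. s u * (p u - q u))"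
    if "sorted_wrt (\<lambda>u v. s u \<ge> s v) ms" "distinct ms" "\<forall>u\<in>set ms. t \<le> s u"
      "\<And>k. k \<le> length ms \<Longrightarrow> 0 \<le> (\<Sum>u\<in>set (take k ms). p u - q u)" for t ms
    using that
  proof (induction ms arbitrary: t rule: rev_induct)
    case (snoc v ms)
    have v: "v \<notin> set ms" using snoc.prems by simp
    have prefix: "0 \<le> (\<Sum>u\<in>set (take k ms). p u - q u)" if "k \<le> length ms" for k
      using snoc.prems(4)[of k] that by simp
    have "s v * (\<Sum>u\<in>set ms. p u - q u) \<le> (\<Sum>u\<in>set ms. s u * (p u - q u))"
      using snoc.prems prefix by (intro snoc.IH) (auto simp: sorted_wrt_append)
    moreover have "t * (\<Sum>u\<in>set (ms @ [v]). p u - q u) \<le> s v * (\<Sum>u\<in>set (ms @ [v]). p u - q u)"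
      using snoc.prems(3) snoc.prems(4)[of "length (ms @ [v])"] by (intro mult_right_mono) auto
    ultimately show ?case using v by (simp add: algebra_simps)
  qed simp
  have "0 * (\<Sum>u\<in>set ms. p u - q u) \<le> (\<Sum>u\<in>set ms. s u * (p u - q u))"
    using assms by (intro gen) (auto simp: sum_subtractf)
  then show ?thesis by (simp add: algebra_simps sum_subtractf)
qed

section \<open>The constant defined by the Lambert function\<close>

text \<open>With \<open>L\<close> the value of the Lambert function,
  \<open>1 - h_bound c = L / beta c\<close>; taking logarithms in
  \<open>L * exp L = beta c * exp (beta c) / c\<close> gives the equation. This is the condition on
  \<open>\<eta>\<close> in \<open>log_gain_vs_exp_accepted\<close>.\<close>

lemma h_bound_equation:
  assumes c: "1 < c"
  shows "0 \<le> h_bound c" "h_bound c < 1"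
    "h_bound c * beta c = ln c + ln (1 - h_bound c)"
proof -
  define g :: "real \<Rightarrow> real" where "g = (\<lambda>x. x * exp x)"
  define b where "b = beta c"
  have b: "0 < b" using beta_pos[OF c] by (simp add: b_def)
  define y where "y = b * exp b / c"
  have y: "0 < y" "y \<le> g b" using b c by (simp_all add: y_def g_def divide_le_eq)
  have "\<exists>L\<ge>0. L \<le> b \<and> g L = y"
    using b y unfolding g_def by (intro IVT) (auto intro!: continuous_intros)
  then obtain L where L: "0 \<le> L" "L \<le> b" "g L = y" by blast
  have "L \<noteq> 0" using L y by (auto simp: g_def)
  then have "0 < L" using L by simp
  have unique: "z = L" if "-1 \<le> z" "g z = y" for z
  proof -
    have "0 < z" using that y by (metis g_def exp_gt_zero zero_less_mult_pos2)
    have mono: "g u < g v" if "0 < u" "u < v" for u v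
      unfolding g_def using that by (intro mult_strict_mono) auto
    show ?thesis using mono[of z L] mono[of L z] \<open>0 < z\<close> \<open>0 < L\<close> that L(3)
      by (cases z L rule: linorder_cases) auto
  qed
  have "Lambert_W y = L"
    unfolding Lambert_W_def the_inv_into_def g_def[symmetric]
    using unique L by (intro the_equality) auto
  then have h: "h_bound c = 1 - L / b"
    by (simp add: h_bound_def b_def y_def)
  then show "0 \<le> h_bound c" "h_bound c < 1" using L b \<open>0 < L\<close> by auto
  have "ln (L * exp L) = ln (b * exp b / c)" using L(3) by (simp add: g_def y_def)
  then have "ln L + L = ln b + b - ln c"
    using \<open>0 < L\<close> b c by (simp add: ln_mult ln_div)
  then have "ln (L / b) = b - L - ln c"
    using \<open>0 < L\<close> b by (simp add: ln_div)
  then show "h_bound c * beta c = ln c + ln (1 - h_bound c)"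
    using b unfolding h b_def[symmetric] by (simp add: algebra_simps)
qed

section \<open>Expected charge of the first machine\<close>

text \<open>The leftover \<open>B\<close> is picked separately for each offset, with no
  measurability in \<open>y\<close>. The integrable minorant \<open>g\<close> carries the
  expectation bound instead.\<close>

lemma first_machine_charge:
  fixes A :: "real multiset"
  assumes c: "1 < c" and A: "A \<subseteq># mset h" "A \<noteq> {#}" and pos: "\<forall>w\<in>set h. 0 < w"
  defines "r \<equiv> min ((c - 1) / (c * ln c)) (h_bound c)"
  shows "\<exists>g I. has_bochner_integral offset_measure g I \<and> r * sum_mset A \<le> I \<and>
    (\<forall>y. \<exists>B. B \<subseteq># mset (rejected (interval_index c y) h) \<and> size B < size A \<and>
       g y \<le> mx (accepted (interval_index c y) h) + r * sum_mset B)"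
proof -
  interpret prob_space offset_measure by (rule prob_space_offset_measure)
  let ?f = "interval_index c" and ?M = "mx h"
  note \<eta> = h_bound_equation[OF c]
  have r: "0 \<le> r" using c \<eta> by (simp add: r_def)
  have "h \<noteq> []" using A by auto
  then have M: "0 < ?M" "?M \<in> set h" using mx_pos mx_in_set pos by auto
  define b where "b = Min (set_mset A)"
  have b: "b \<in># A" "\<And>a. a \<in># A \<Longrightarrow> b \<le> a" using A(2) by (auto simp: b_def)
  have bM: "b \<le> ?M" using b(1) A(1) mx_ge mset_subset_eqD by fastforce
  \<comment> \<open>The level whose index is exactly one below that of the largest job, for every
    offset.\<close>
  define a where "a = ?M / c"
  have a: "0 < a" using M c by (simp add: a_def)
  have h_le: "\<forall>w\<in>set h. 0 < w \<and> w \<le> c * a" using pos mx_ge c by (simp add: a_def)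
  have reward: "has_bochner_integral offset_measure (\<lambda>y. reward_above (?f y) a h) (log_gain a h / ln c)"
    using expectation_reward_above[OF c h_le a] .
  have idx: "?f y w \<le> ?f y v + 1" if "v \<in> {0<..}" "a \<le> v" "w \<in> set h" for v w y
  proof (rule interval_index_le_add_one[OF c])
    have "c * a \<le> c * v" using that c by simp
    then show "w \<le> c * v" using h_le that by force
  qed (use that pos in auto)
  have reward_le: "reward_above (?f y) a h \<le> mx (accepted (?f y) h)" for y
    using idx[of a _ y] a pos by (intro reward_above_le[OF interval_index_mono[OF c]]) auto
  have const: "has_bochner_integral offset_measure (\<lambda>y. k) k" for k :: real
    by (simp add: has_bochner_integral_iff prob_space)
  show ?thesis
  \<comment> \<open>If such a record exists, the loss of \<open>A\<close> is at most
    \<open>?M\<close>; otherwise \<open>b\<close> is at most the accepted total, which therefore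
    bounds the loss even if no job of \<open>A\<close> is accepted.\<close>
  proof (cases "\<exists>h1 v h2. h = h2 @ v # h1 \<and> (\<forall>u\<in>set h1. u < v) \<and> a \<le> v \<and> v < b")
    case True
    then obtain h1 v h2 where v: "h = h2 @ v # h1" "\<forall>u\<in>set h1. u < v" "a \<le> v" "v < b" by blast
    have "0 < v" using v(1) pos by simp
    have "\<exists>B. B \<subseteq># mset (rejected (?f y) h) \<and> size B < size A \<and> sum_mset A - ?M \<le> sum_mset B" for y
    proof (rule charge_exists[OF A b(2,1)])
      show "sum_mset (A \<inter># mset (accepted (?f y) h)) \<le> ?M"
        using hit_le_mx[OF A(1) b(2) v(1,2,4)] idx[of v _ y] v(3) \<open>0 < v\<close> by auto
    qed (use bM in auto)
    then obtain B where B: "\<And>y. B y \<subseteq># mset (rejected (?f y) h)" "\<And>y. size (B y) < size A"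
      "\<And>y. sum_mset A - ?M \<le> sum_mset (B y)" by metis
    \<comment> \<open>The first term of the minimum is the one for which its product with
      \<open>?M\<close> equals \<open>(?M - a) / ln c\<close>.\<close>
    have "r * ?M \<le> (c - 1) / (c * ln c) * ?M"
      using M by (intro mult_right_mono) (auto simp: r_def)
    also have "\<dots> = (?M - a) / ln c" using c by (simp add: a_def field_simps)
    also have "\<dots> \<le> log_gain a h / ln c" using log_gain_ge[OF a] c by (intro divide_right_mono) auto
    finally have "r * sum_mset A \<le> log_gain a h / ln c + r * (sum_mset A - ?M)"
      by (simp add: algebra_simps)
    moreover have "reward_above (?f y) a h + r * (sum_mset A - ?M) \<le>
        mx (accepted (?f y) h) + r * sum_mset (B y)" for y
      using reward_le B(3) r by (intro add_mono mult_left_mono) auto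
    ultimately show ?thesis
      using has_bochner_integral_add[OF reward const] B(1,2) by blast
  next
    case False
    have "\<exists>B. B \<subseteq># mset (rejected (?f y) h) \<and> size B < size A \<and>
        sum_mset A - sum_list (accepted (?f y) h) \<le> sum_mset B" for y
    proof (rule charge_exists[OF A b(2,1)])
      show "sum_mset (A \<inter># mset (accepted (?f y) h)) \<le> sum_list (accepted (?f y) h)"
        by (rule hit_le_accepted[OF pos])
      show "b \<le> sum_list (accepted (?f y) h)"
      proof (rule miss_le_accepted[OF pos \<open>h \<noteq> []\<close> _ interval_index_mono[OF c] a])
        fix h1 v h2
        assume "h = h2 @ v # h1" "\<forall>u\<in>set h1. u < v" "a \<le> v"
        then have "\<not> v < b" using False by blast
        then show "b \<le> v" by simp
      next
        show "?f y a < ?f y ?M" using interval_index_div[OF c M(1)] by (simp add: a_def)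
      qed
    qed
    then obtain B where B: "\<And>y. B y \<subseteq># mset (rejected (?f y) h)" "\<And>y. size (B y) < size A"
      "\<And>y. sum_mset A - sum_list (accepted (?f y) h) \<le> sum_mset (B y)" by metis
    note accepted = expectation_accepted[OF c pos]
    have "0 \<le> exp_accepted c h"
      using accepted accepted_nonneg[OF pos] by (metis Bochner_Integration.integral_nonneg has_bochner_integral_integral_eq)
    then have "r * exp_accepted c h \<le> h_bound c * exp_accepted c h"
      by (intro mult_right_mono) (auto simp: r_def)
    also have "\<dots> \<le> log_gain a h / ln c"
      using exp_accepted_le_log_gain[OF c \<eta> pos \<open>h \<noteq> []\<close>] c by (simp add: a_def field_simps)
    finally have "r * sum_mset A \<le> log_gain a h / ln c + r * (sum_mset A - exp_accepted c h)"
      by (simp add: algebra_simps)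
    moreover have "has_bochner_integral offset_measure
        (\<lambda>y. reward_above (?f y) a h + r * (sum_mset A - sum_list (accepted (?f y) h)))
        (log_gain a h / ln c + r * (sum_mset A - exp_accepted c h))"
      by (intro has_bochner_integral_add reward has_bochner_integral_mult_right
          has_bochner_integral_diff const accepted)
    moreover have "reward_above (?f y) a h + r * (sum_mset A - sum_list (accepted (?f y) h)) \<le>
        mx (accepted (?f y) h) + r * sum_mset (B y)" for y
      using reward_le B(3) r by (intro add_mono mult_left_mono) auto
    ultimately show ?thesis using B(1,2) by meson
  qed
qed

section \<open>Measurability\<close>

lemma measurable_interval_index:
  assumes "1 < c" "0 < w"
  shows "(\<lambda>y. interval_index c y w) \<in> measurable borel (count_space UNIV)"
  unfolding interval_index_eq[OF assms] by measurable

lemma pred_all_less: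
  assumes "1 < c" "0 < w" "\<forall>v\<in>set h. 0 < v"
  shows "Measurable.pred borel (\<lambda>y. \<forall>v\<in>set h. interval_index c y v < interval_index c y w)"
proof (intro pred_intros_finite(3))
  fix v assume "v \<in> set h"
  note [measurable] = measurable_interval_index[OF assms(1,2)]
    measurable_interval_index[OF assms(1), of v]
  show "Measurable.pred borel (\<lambda>y. interval_index c y v < interval_index c y w)"
    using assms(3) \<open>v \<in> set h\<close> by simp measurable
qed simp

lemma measurable_accepted_rejected:
  assumes "1 < c" "\<forall>w\<in>set h. 0 < w"
  shows "(\<lambda>y. accepted (interval_index c y) h) \<in> measurable borel (count_space UNIV) \<and>
    (\<lambda>y. rejected (interval_index c y) h) \<in> measurable borel (count_space UNIV)"
  using assms(2)
proof (induction h)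
  case (Cons w h)
  then have IH [measurable]: "(\<lambda>y. accepted (interval_index c y) h) \<in> measurable borel (count_space UNIV)"
    "(\<lambda>y. rejected (interval_index c y) h) \<in> measurable borel (count_space UNIV)" by auto
  have [measurable]: "Measurable.pred borel (\<lambda>y. \<forall>v\<in>set h. interval_index c y v < interval_index c y w)"
    using assms(1) Cons.prems by (intro pred_all_less) auto
  have [measurable]: "(\<lambda>y. w # accepted (interval_index c y) h) \<in> measurable borel (count_space UNIV)"
    "(\<lambda>y. w # rejected (interval_index c y) h) \<in> measurable borel (count_space UNIV)"
    using IH[THEN measurable_compose, of "(#) w" "count_space UNIV"] by simp_all
  show ?case unfolding accepted.simps rejected.simps by (intro conjI; measurable)
qed simp

lemma measurable_machine_reward:
  fixes ms :: "'m list"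
  assumes c: "1 < c"
  shows "set ms \<subseteq> V \<Longrightarrow> \<forall>w\<in>set h. 0 < w \<Longrightarrow>
    (\<lambda>x. machine_reward c x ms h u) \<in> borel_measurable (offsets V)"
proof (induction ms arbitrary: h)
  case (Cons v ms)
  have comp: "(\<lambda>x. x v) \<in> measurable (offsets V) borel"
    using measurable_component_singleton[of v V "\<lambda>_. offset_measure"] Cons.prems(1)
    unfolding offsets_def by (simp cong: measurable_cong_sets)
  note acc_rej = measurable_accepted_rejected[OF c Cons.prems(2)]
  have "(\<lambda>x. mx (accepted (interval_index c (x v)) h)) \<in> borel_measurable (offsets V)"
    by (rule measurable_compose[OF measurable_compose[OF comp acc_rej[THEN conjunct1]]]) simp
  moreover have "(\<lambda>x. machine_reward c x ms (rejected (interval_index c (x v)) h) u)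
      \<in> borel_measurable (offsets V)"
  \<comment> \<open>The list passed on is random but takes finitely many values, so the induction
    hypothesis is needed for each fixed list only.\<close>
  proof (rule measurable_compose_countable'[where I = "{l. set l \<subseteq> set h \<and> length l \<le> length h}"])
    show "countable {l. set l \<subseteq> set h \<and> length l \<le> length h}"
      by (intro countable_finite finite_lists_length_le) simp
    have "(\<lambda>x. rejected (interval_index c (x v)) h) \<in> measurable (offsets V) (count_space UNIV)"
      by (rule measurable_compose[OF comp acc_rej[THEN conjunct2]])
    then show "(\<lambda>x. rejected (interval_index c (x v)) h) \<in>
        measurable (offsets V) (count_space {l. set l \<subseteq> set h \<and> length l \<le> length h})"
      using set_rejected length_rejected
      by (auto simp: measurable_def subset_iff)
  qed (use Cons in auto)
  ultimately show ?case by (cases "u = v") auto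
qed simp

section \<open>Induction over the machines and the competitive ratio\<close>

text \<open>The offset \<open>y\<close> of the first machine is fixed, the induction hypothesis is
  applied to the rejected jobs and the leftover \<open>B\<close> from
  \<open>first_machine_charge\<close>, and Tonelli integrates over \<open>y\<close>.\<close>

lemma expected_prefix_reward:
  fixes A :: "real multiset" and ms :: "'m list"
  assumes c: "1 < c"
  defines "r \<equiv> min ((c - 1) / (c * ln c)) (h_bound c)"
  shows "finite V \<Longrightarrow> distinct ms \<Longrightarrow> set ms \<subseteq> V \<Longrightarrow> \<forall>w\<in>set h. 0 < w \<Longrightarrow>
    A \<subseteq># mset h \<Longrightarrow> size A \<le> k \<Longrightarrow> k \<le> length ms \<Longrightarrow>
    ennreal (r * sum_mset A) \<le>
      (\<integral>\<^sup>+x. ennreal (\<Sum>u\<in>set (take k ms). machine_reward c x ms h u) \<partial>offsets V)"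
proof (induction ms arbitrary: V h A k)
  case (Cons v ms)
  show ?case
  proof (cases "A = {#}")
    case A: False
    then obtain k' where k: "k = Suc k'" using Cons.prems by (cases k) auto
    let ?f = "interval_index c" and ?W = "V - {v}"
    let ?S = "\<lambda>x h. \<Sum>u\<in>set (take k' ms). machine_reward c x ms h u"
    have V: "V = insert v ?W" "finite ?W" "v \<notin> ?W" and v: "v \<notin> set ms"
      using Cons.prems by auto
    interpret product_sigma_finite "\<lambda>_::'m. offset_measure"
      by (simp add: product_sigma_finite_def prob_space_imp_sigma_finite prob_space_offset_measure)
    interpret W: prob_space "offsets ?W"
      unfolding offsets_def by (intro prob_space_PiM prob_space_offset_measure)
    have r: "0 \<le> r" using h_bound_equation[OF c] c by (simp add: r_def)
    have split: "(\<Sum>u\<in>set (take k (v # ms)). machine_reward c (x(v := y)) (v # ms) h u) =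
        mx (accepted (?f y) h) + ?S x (rejected (?f y) h)" for x y
    proof -
      have v': "v \<notin> set (take k' ms)" using v in_set_takeD by metis
      then have "(\<Sum>u\<in>set (take k' ms). machine_reward c (x(v := y)) (v # ms) h u) =
          ?S x (rejected (?f y) h)"
        using v by (intro sum.cong) (auto simp: machine_reward_fun_upd)
      then show ?thesis using v' by (simp add: k)
    qed
    have S_nonneg: "0 \<le> ?S x l" for x l by (intro sum_nonneg machine_reward_nonneg)
    have S_measurable: "(\<lambda>x. ?S x l) \<in> borel_measurable (offsets ?W)" if "\<forall>w\<in>set l. 0 < w" for l
      using Cons.prems(3) v that by (intro borel_measurable_sum measurable_machine_reward[OF c]) auto
    obtain g I where g: "has_bochner_integral offset_measure g I" "r * sum_mset A \<le> I"
      "\<And>y. \<exists>B. B \<subseteq># mset (rejected (?f y) h) \<and> size B < size A \<and>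
         g y \<le> mx (accepted (?f y) h) + r * sum_mset B"
      using first_machine_charge[OF c Cons.prems(5) A Cons.prems(4)] unfolding r_def by blast
    have inner: "ennreal (g y) \<le>
        (\<integral>\<^sup>+x. ennreal (mx (accepted (?f y) h) + ?S x (rejected (?f y) h)) \<partial>offsets ?W)" for y
    proof -
      let ?l = "rejected (?f y) h"
      obtain B where B: "B \<subseteq># mset ?l" "size B < size A" "g y \<le> mx (accepted (?f y) h) + r * sum_mset B"
        using g(3) by blast
      have pos: "\<forall>w\<in>set ?l. 0 < w" using set_rejected Cons.prems(4) by blast
      have "\<forall>w. w \<in># B \<longrightarrow> 0 < w" using mset_subset_eqD[OF B(1)] pos by auto
      then have "0 \<le> sum_mset B"
        by (induction B) (auto intro: add_nonneg_nonneg less_imp_le)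
      have IH: "ennreal (r * sum_mset B) \<le> (\<integral>\<^sup>+x. ennreal (?S x ?l) \<partial>offsets ?W)"
        using Cons.prems B v k pos by (intro Cons.IH) auto
      have "ennreal (g y) \<le> ennreal (mx (accepted (?f y) h)) + ennreal (r * sum_mset B)"
        using B(3) r \<open>0 \<le> sum_mset B\<close> mx_nonneg by (simp add: ennreal_plus[symmetric] del: ennreal_plus)
      also have "\<dots> \<le> (\<integral>\<^sup>+x. ennreal (mx (accepted (?f y) h)) \<partial>offsets ?W) +
          (\<integral>\<^sup>+x. ennreal (?S x ?l) \<partial>offsets ?W)"
        using IH W.emeasure_space_1 by (intro add_mono) auto
      also have "\<dots> = (\<integral>\<^sup>+x. ennreal (mx (accepted (?f y) h)) + ennreal (?S x ?l) \<partial>offsets ?W)"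
        using S_measurable[OF pos] by (intro nn_integral_add[symmetric]) auto
      also have "\<dots> = (\<integral>\<^sup>+x. ennreal (mx (accepted (?f y) h) + ?S x ?l) \<partial>offsets ?W)"
        using S_nonneg mx_nonneg by (simp add: ennreal_plus)
      finally show ?thesis .
    qed
    have "(\<lambda>x. \<Sum>u\<in>set (take k (v # ms)). machine_reward c x (v # ms) h u) \<in> borel_measurable (offsets V)"
      using Cons.prems by (intro borel_measurable_sum measurable_machine_reward[OF c]) auto
    then have meas: "(\<lambda>x. ennreal (\<Sum>u\<in>set (take k (v # ms)). machine_reward c x (v # ms) h u))
        \<in> borel_measurable (Pi\<^sub>M (insert v ?W) (\<lambda>_. offset_measure))"
      using V(1) by (simp add: offsets_def)
    have "ennreal (r * sum_mset A) \<le> ennreal I" using g(2) by (rule ennreal_leI)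
    also have "ennreal I \<le> (\<integral>\<^sup>+y. ennreal (g y) \<partial>offset_measure)"
    proof -
      \<comment> \<open>\<open>g\<close> may be negative, while \<open>ennreal\<close> truncates at
        0; the positive part links the two integrals.\<close>
      have "I \<le> (\<integral>y. max 0 (g y) \<partial>offset_measure)"
        using g(1) unfolding has_bochner_integral_iff
        by (auto intro!: integral_mono integrable_max)
      then have "ennreal I \<le> ennreal (\<integral>y. max 0 (g y) \<partial>offset_measure)" by (rule ennreal_leI)
      also have "\<dots> = (\<integral>\<^sup>+y. ennreal (max 0 (g y)) \<partial>offset_measure)"
        using g(1) unfolding has_bochner_integral_iff
        by (intro nn_integral_eq_integral[symmetric]) (auto intro!: integrable_max)
      moreover have "ennreal (max 0 (g y)) = ennreal (g y)" for y
        by (cases "0 \<le> g y") (auto simp: ennreal_neg max_def)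
      ultimately show ?thesis by simp
    qed
    also have "\<dots> \<le> (\<integral>\<^sup>+y. (\<integral>\<^sup>+x. ennreal (mx (accepted (?f y) h) + ?S x (rejected (?f y) h)) \<partial>offsets ?W)
        \<partial>offset_measure)"
      by (intro nn_integral_mono inner)
    also have "\<dots> = (\<integral>\<^sup>+x. ennreal (\<Sum>u\<in>set (take k (v # ms)). machine_reward c x (v # ms) h u)
        \<partial>Pi\<^sub>M (insert v ?W) (\<lambda>_. offset_measure))"
      unfolding product_nn_integral_insert_rev[OF V(2,3) meas] split offsets_def ..
    finally show ?thesis using V(1) by (simp add: offsets_def)
  qed simp
qed simp

lemma integrable_machine_reward:
  fixes ms :: "'m list"
  assumes "1 < c" "set ms \<subseteq> V" "\<forall>w\<in>set h. 0 < w"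
  shows "integrable (offsets V) (\<lambda>x. machine_reward c x ms h u)"
proof -
  interpret prob_space "offsets V"
    unfolding offsets_def by (intro prob_space_PiM prob_space_offset_measure)
  show ?thesis
    using machine_reward_nonneg[of c _ ms h u] machine_reward_le[of c _ ms h u]
    by (intro integrable_const_bound[where B = "mx h"] measurable_machine_reward assms) auto
qed

lemma competitive_ratio:
  assumes c: "1 < c"
  shows "has_competitive_ratio
    (expected_reward c :: 'm set \<Rightarrow> ('m \<Rightarrow> real) \<Rightarrow> 'm list \<Rightarrow> real list \<Rightarrow> real)
    (min ((c - 1) / (c * ln c)) (h_bound c))"
  unfolding has_competitive_ratio_def
proof (intro allI impI)
  fix V :: "'m set" and s :: "'m \<Rightarrow> real" and ms :: "'m list" and ws :: "real list"
  assume V: "finite V" and s: "\<forall>u\<in>V. s u > 0" and "checking_order V s ms"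
    and pos: "\<forall>w\<in>set ws. w > 0"
  then have ms: "V = set ms" "distinct ms" "sorted_wrt (\<lambda>u v. s u \<ge> s v) ms"
    by (auto simp: checking_order_def)
  let ?r = "min ((c - 1) / (c * ln c)) (h_bound c)"
  define p where "p u = (\<integral>x. machine_reward c x ms (rev ws) u \<partial>offsets V)" for u
  have int: "integrable (offsets V) (\<lambda>x. machine_reward c x ms (rev ws) u)" for u
    using c ms pos by (intro integrable_machine_reward) auto
  have E: "expected_reward c V s ms ws = (\<Sum>u\<in>set ms. s u * p u)"
    unfolding expected_reward_def ms(1) total_reward_run[OF ms(2)]
    using int by (simp add: p_def ms(1))
  let ?T = "{total_reward V s (zip ws as) | as. length as = length ws \<and> set as \<subseteq> insert None (Some ` V)}"
  have "?T = (\<lambda>as. total_reward V s (zip ws as)) `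
      {as. set as \<subseteq> insert None (Some ` V) \<and> length as = length ws}" by auto
  then have "finite ?T" using V by (simp add: finite_lists_length_eq)
  moreover have "total_reward V s (zip ws (replicate (length ws) None)) \<in> ?T" by force
  ultimately have "offline_opt V s ws \<in> ?T"
    unfolding offline_opt_def using Max_in by blast
  then obtain as where as: "offline_opt V s ws = total_reward V s (zip ws as)" "length as = length ws"
    by auto
  let ?H = "zip ws as"
  \<comment> \<open>The scaled offline reward per machine. For every prefix of the checking order
    its sum is \<open>?r\<close> times the total of a multiset of at most \<open>k\<close> jobs, as
    \<open>expected_prefix_reward\<close> requires.\<close>
  define q where "q u = ?r * Max (insert 0 (jobs_of ?H u))" for u
  have "?r * offline_opt V s ws = (\<Sum>u\<in>set ms. s u * q u)"
    unfolding as(1) total_reward_def q_def jobs_of_def sum_distrib_left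
    by (intro sum.cong[OF ms(1)]) (simp add: mult.left_commute)
  also have "\<dots> \<le> (\<Sum>u\<in>set ms. s u * p u)"
  proof (rule weighted_sum_mono[OF ms(3,2)])
    show "\<forall>u\<in>set ms. 0 \<le> s u" using s ms(1) by (auto intro: less_imp_le)
    fix k assume k: "k \<le> length ms"
    let ?U = "set (take k ms)"
    have "\<forall>p\<in>set ?H. 0 < fst p" using pos by (auto dest: set_zip_leftD)
    then obtain A where A: "A \<subseteq># image_mset fst (filter_mset (\<lambda>p. snd p \<in> Some ` ?U) (mset ?H))"
      "size A \<le> card ?U" "sum_mset A = (\<Sum>u\<in>?U. Max (insert 0 (jobs_of ?H u)))"
      using offline_submultiset[of ?U ?H] by auto
    have "image_mset fst (filter_mset (\<lambda>p. snd p \<in> Some ` ?U) (mset ?H)) \<subseteq># image_mset fst (mset ?H)"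
      by (intro image_mset_subseteq_mono) simp
    also have "image_mset fst (mset ?H) = mset (rev ws)"
      using as(2) by (metis map_fst_zip mset_map mset_rev)
    finally have "A \<subseteq># mset (rev ws)" using A(1) by simp
    moreover have "size A \<le> k" using A(2) ms(2) k by (simp add: distinct_card)
    ultimately have "ennreal (?r * sum_mset A) \<le>
        (\<integral>\<^sup>+x. ennreal (\<Sum>u\<in>?U. machine_reward c x ms (rev ws) u) \<partial>offsets V)"
      using expected_prefix_reward[OF c V ms(2), of "rev ws" A k] ms(1) pos k by simp
    also have "\<dots> = ennreal (\<integral>x. (\<Sum>u\<in>?U. machine_reward c x ms (rev ws) u) \<partial>offsets V)"
      using int by (intro nn_integral_eq_integral) (auto intro!: sum_nonneg machine_reward_nonneg)
    also have "(\<integral>x. (\<Sum>u\<in>?U. machine_reward c x ms (rev ws) u) \<partial>offsets V) = (\<Sum>u\<in>?U. p u)"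
      using int by (simp add: p_def)
    finally have "?r * sum_mset A \<le> (\<Sum>u\<in>?U. p u)"
      by (subst (asm) ennreal_le_iff) (auto simp: p_def intro!: sum_nonneg Bochner_Integration.integral_nonneg machine_reward_nonneg)
    then show "(\<Sum>u\<in>?U. q u) \<le> (\<Sum>u\<in>?U. p u)"
      by (simp add: q_def A(3) sum_distrib_left)
  qed
  finally show "?r * offline_opt V s ws \<le> expected_reward c V s ms ws" by (simp add: E)
qed

section \<open>Numerical values for c = 3.55829\<close>

lemma ln_2_bounds: "0.693145 \<le> ln (2::real)" "ln (2::real) \<le> 0.693149"
  using ln_approx_bounds[of 2 5] by (simp_all add: eval_nat_numeral)

lemma ln_3_55829_bounds: "1.26927 \<le> ln (3.55829::real)" "ln (3.55829::real) \<le> 1.2693"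
proof -
  \<comment> \<open>The fraction 32/9 is so close that \<open>ln t \<le> t - 1\<close>, applied to
    the remaining factor and its inverse, is precise enough.\<close>
  have "(3.55829::real) = 2 * 2 / (9 / 8) * (3.55829 * 9 / 32)" by simp
  then have "ln (3.55829::real) = ln (2 * 2 / (9 / 8) * (3.55829 * 9 / 32))" by (rule arg_cong)
  also have "\<dots> = ln (2 * 2 / (9 / 8)) + ln (3.55829 * 9 / 32)" by (rule ln_mult_pos) simp_all
  also have "ln (2 * 2 / (9 / 8) :: real) = ln (2 * 2) - ln (9 / 8)" by (rule ln_divide_pos) simp_all
  also have "ln (2 * 2 :: real) = 2 * ln 2" by (subst ln_mult_pos) simp_all
  finally have eq: "ln (3.55829::real) = 2 * ln 2 - ln (9 / 8) + ln (3.55829 * 9 / 32)" .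
  have "0.11778 \<le> ln (9 / 8 :: real)" "ln (9 / 8 :: real) \<le> 0.117784"
    using ln_approx_bounds[of "9 / 8" 2] by (simp_all add: eval_nat_numeral)
  moreover have "ln (3.55829 * 9 / 32 :: real) \<le> 0.00077"
    using ln_le_minus_one[of "3.55829 * 9 / 32 :: real"] by simp
  moreover have "0.000768 \<le> ln (3.55829 * 9 / 32 :: real)"
    using ln_le_minus_one[of "1 / (3.55829 * 9 / 32) :: real"] by (simp add: ln_divide_pos)
  ultimately show "1.26927 \<le> ln (3.55829::real)" "ln (3.55829::real) \<le> 1.2693"
    unfolding eq using ln_2_bounds by simp_all
qed

text \<open>The argument is \<open>1 - 0.56635\<close>, and its inverse is close to
  \<open>2 * (23 / 20)\<close>.\<close>

lemma ln_0_43365_ge: "- 0.8356 \<le> ln (0.43365::real)"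
proof -
  have "(1::real) = 2 * (23 / 20) * (20 / (46 * 0.43365)) * 0.43365" by simp
  then have "0 = ln (2 * (23 / 20) * (20 / (46 * 0.43365)) * (0.43365::real))" by simp
  also have "\<dots> = ln 2 + ln (23 / 20) + ln (20 / (46 * 0.43365)) + ln 0.43365"
    by (subst ln_mult_pos, simp, simp)+ simp
  finally have eq: "ln (0.43365::real) = - ln 2 - ln (23 / 20) - ln (20 / (46 * 0.43365))" by linarith
  have "ln (23 / 20 :: real) \<le> 0.139763"
    using ln_approx_bounds[of "23 / 20" 2] by (simp add: eval_nat_numeral)
  moreover have "ln (20 / (46 * 0.43365) :: real) \<le> 0.002619"
    using ln_le_minus_one[of "20 / (46 * 0.43365) :: real"] by simp
  ultimately show ?thesis unfolding eq using ln_2_bounds(2) by simp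
qed

text \<open>The first term of the minimum is bounded on both sides, so a lower bound for
  \<open>h_bound\<close> suffices. A smaller value \<eta> would make \<open>\<eta> * beta c\<close>
  fall below \<open>ln c + ln (1 - \<eta>)\<close>, contradicting
  \<open>h_bound_equation\<close>.\<close>

lemma ratio_approx:
  "\<bar>min ((3.55829 - 1) / (3.55829 * ln 3.55829)) (h_bound 3.55829) - 0.5664\<bar> \<le> (0.00005::real)"
proof -
  let ?c = "3.55829 :: real"
  note l = ln_3_55829_bounds
  have 1: "(?c - 1) / (?c * ln ?c) \<le> 0.56645" "0.56635 \<le> (?c - 1) / (?c * ln ?c)"
    using l by (auto simp: field_simps)
  have "0.56635 \<le> h_bound ?c"
  proof (rule ccontr)
    define \<eta> where "\<eta> = h_bound ?c"
    assume "\<not> 0.56635 \<le> h_bound ?c"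
    then have less: "\<eta> < 0.56635" by (simp add: \<eta>_def)
    have b: "beta ?c = ?c / (?c - 1) * ln ?c - 1" by (simp add: beta_def)
    have "\<eta> * beta ?c < 0.56635 * beta ?c"
      using less beta_pos[of ?c] by (intro mult_strict_right_mono) auto
    also have "\<dots> \<le> ln ?c - 0.8356" unfolding b using l by (simp add: field_simps)
    also have "\<dots> \<le> ln ?c + ln 0.43365" using ln_0_43365_ge by simp
    also have "\<dots> \<le> ln ?c + ln (1 - \<eta>)" using less by simp
    also have "\<dots> = \<eta> * beta ?c" using h_bound_equation(3)[of ?c] by (simp add: \<eta>_def)
    finally show False by simp
  qed
  with 1 show ?thesis unfolding min_def abs_le_iff by auto
qed

theorem theorem2:
  shows "(\<forall>c::real. c \<ge> exp 1 \<longrightarrow>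
            has_competitive_ratio
              (expected_reward c :: 'm set \<Rightarrow> ('m \<Rightarrow> real) \<Rightarrow> 'm list \<Rightarrow> real list \<Rightarrow> real)
              (min ((c - 1) / (c * ln c)) (h_bound c))) \<and>
         (\<exists>r::real. \<bar>r - 0.5664\<bar> \<le> 0.00005 \<and>
            r = min ((3.55829 - 1) / (3.55829 * ln 3.55829)) (h_bound 3.55829) \<and>
            has_competitive_ratio
              (expected_reward 3.55829 :: 'm set \<Rightarrow> ('m \<Rightarrow> real) \<Rightarrow> 'm list \<Rightarrow> real list \<Rightarrow> real) r)"
proof (intro conjI allI impI exI[of _ "min ((3.55829 - 1) / (3.55829 * ln 3.55829)) (h_bound 3.55829)"])
  fix c :: real
  assume "exp 1 \<le> c"
  moreover have "1 < exp (1::real)" by simp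
  ultimately have "1 < c" by linarith
  then show "has_competitive_ratio
      (expected_reward c :: 'm set \<Rightarrow> ('m \<Rightarrow> real) \<Rightarrow> 'm list \<Rightarrow> real list \<Rightarrow> real)
      (min ((c - 1) / (c * ln c)) (h_bound c))"
    by (rule competitive_ratio)
qed (use ratio_approx competitive_ratio[of "3.55829"] in simp_all)

end
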